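(* Let $\mathbb{R}^2$ be equipped with the Euclidean metric, and let $\mathbb{Z}^2\subset\mathbb{R}^2$ be the integer lattice equipped with the restriction of the Euclidean metric. Then $$d_{GH}(\mathbb{Z}^2,\mathbb{R}^2)=d_H(\mathbb{Z}^2,\mathbb{R}^2),$$ where $d_{GH}$ is the Gromov--Hausdorff distance and $d_H$ is the Hausdorff distance between subsets of $\mathbb{R}^2$.
   Context: Metric spaces are non-empty and not assumed bounded. For a metric space $Z$, a point $a\in Z$ and $r>0$, put $U_r(a)=\{x\in Z : d_Z(a,x)<r\}$, and for $A\subset Z$ put $U_r(A)=\bigcup_{a\in A}U_r(a)$. The Hausdorff distance between non-empty subsets $A,B$ of a metric space is $d_H(A,B)=\inf\{r>0 : A\subset U_r(B),\ B\subset U_r(A)\}$. The Gromov--Hausdorff distance $d_{GH}(X,Y)$ between metric spaces $X$ and $Y$ is the infimum of the numbers $r\ge 0$ for which there exist a metric space $Z$ and subsets $X',Y'\subset Z$, isometric to $X$ and $Y$ respectively, such that $d_H(X',Y')\le r$ (it equals $\infty$ if there is no such $r$). *)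

theory Defs
  imports "HOL-Analysis.Analysis"
begin

definition metric_nbhd :: "'a metric \<Rightarrow> real \<Rightarrow> 'a set \<Rightarrow> 'a set" where
  "metric_nbhd Z r A = (\<Union>a\<in>A. mball_of Z a r)"

text \<open>Metric spaces may be unbounded, so distances between sets and between spaces are
  \<^typ>\<open>ereal\<close>-valued; the infimum of the empty set is \<^term>\<open>\<infinity> :: ereal\<close>.
  \<open>hausdorff_distance Z A B\<close> is meant for non-empty subsets of \<open>mspace Z\<close>.\<close>

definition hausdorff_distance :: "'a metric \<Rightarrow> 'a set \<Rightarrow> 'a set \<Rightarrow> ereal" where
  "hausdorff_distance Z A B =
     Inf {ereal r | r. 0 < r \<and> A \<subseteq> metric_nbhd Z r B \<and> B \<subseteq> metric_nbhd Z r A}"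

definition isometric_spaces :: "'a metric \<Rightarrow> 'b metric \<Rightarrow> bool" where
  "isometric_spaces X Y \<longleftrightarrow>
     (\<exists>f. bij_betw f (mspace X) (mspace Y) \<and>
          (\<forall>x\<in>mspace X. \<forall>y\<in>mspace X. mdist Y (f x) (f y) = mdist X x y))"

text \<open>Types cannot be quantified over inside a formula, so the ambient space \<open>Z\<close> ranges over all
  metric spaces whose points are taken from the sum type of the point types of \<open>X\<close> and \<open>Y\<close>.
  This is no restriction: \<open>gromov_hausdorff_distance_le\<close> below shows that
  ambient spaces over arbitrary types give the same infimum.\<close>

definition gromov_hausdorff_distance :: "'a metric \<Rightarrow> 'b metric \<Rightarrow> ereal" where
  "gromov_hausdorff_distance X Y =
     Inf {ereal r | r. 0 \<le> r \<and>
       (\<exists>(Z :: ('a + 'b) metric) X' Y'.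
          X' \<subseteq> mspace Z \<and> Y' \<subseteq> mspace Z \<and>
          isometric_spaces (submetric Z X') X \<and> isometric_spaces (submetric Z Y') Y \<and>
          hausdorff_distance Z X' Y' \<le> ereal r)}"

definition integer_lattice :: "(real ^ 'n) set" where
  "integer_lattice = {x. \<forall>i. x $ i \<in> \<int>}"

lemma mem_metric_nbhd:
  "x \<in> metric_nbhd Z r A \<longleftrightarrow> (\<exists>a\<in>A. a \<in> mspace Z \<and> x \<in> mspace Z \<and> mdist Z a x < r)"
proof -
  interpret Metric_space "mspace Z" "mdist Z" by (rule Metric_space_mspace_mdist)
  show ?thesis unfolding metric_nbhd_def mball_of_def by auto
qed

lemma hausdorff_distance_image:
  assumes k: "k ` mspace W \<subseteq> mspace Z"
    and iso: "\<And>p q. p \<in> mspace W \<Longrightarrow> q \<in> mspace W \<Longrightarrow> mdist W p q = mdist Z (k p) (k q)"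
    and A: "A \<subseteq> mspace W" and B: "B \<subseteq> mspace W"
  shows "hausdorff_distance W A B = hausdorff_distance Z (k ` A) (k ` B)"
proof -
  have sub: "C \<subseteq> metric_nbhd W r D \<longleftrightarrow> k ` C \<subseteq> metric_nbhd Z r (k ` D)"
    if C: "C \<subseteq> mspace W" and D: "D \<subseteq> mspace W" for C D r
  proof -
    have "x \<in> metric_nbhd W r D \<longleftrightarrow> k x \<in> metric_nbhd Z r (k ` D)" if "x \<in> C" for x
    proof -
      have "x \<in> mspace W" using that C by blast
      then show ?thesis
        unfolding mem_metric_nbhd using D k iso by (auto simp: subset_iff)
    qed
    then show ?thesis by blast
  qed
  show ?thesis
    unfolding hausdorff_distance_def sub[OF A B] sub[OF B A] ..
qed

lemma gromov_hausdorff_distance_le: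
  fixes X :: "'a metric" and Y :: "'b metric" and Z :: "'c metric"
  assumes X': "X' \<subseteq> mspace Z" and Y': "Y' \<subseteq> mspace Z"
    and isoX: "isometric_spaces (submetric Z X') X"
    and isoY: "isometric_spaces (submetric Z Y') Y"
    and r: "0 \<le> r" "hausdorff_distance Z X' Y' \<le> ereal r"
  shows "gromov_hausdorff_distance X Y \<le> ereal r"
proof -
  from isoX X' obtain f where f: "bij_betw f X' (mspace X)"
    and fd: "\<And>x y. x \<in> X' \<Longrightarrow> y \<in> X' \<Longrightarrow> mdist X (f x) (f y) = mdist Z x y"
    unfolding isometric_spaces_def by (auto simp: Int_absorb2)
  from isoY Y' obtain g where g: "bij_betw g Y' (mspace Y)"
    and gd: "\<And>x y. x \<in> Y' \<Longrightarrow> y \<in> Y' \<Longrightarrow> mdist Y (g x) (g y) = mdist Z x y"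
    unfolding isometric_spaces_def by (auto simp: Int_absorb2)
  define U where "U = X' \<union> Y'"
  define j :: "'c \<Rightarrow> 'a + 'b" where "j z = (if z \<in> X' then Inl (f z) else Inr (g z))" for z
  have injj: "inj_on j U"
    using f g unfolding U_def inj_on_def j_def bij_betw_def by auto
  define k where "k = inv_into U j"
  have kj: "k (j z) = z" if "z \<in> U" for z
    using injj that by (simp add: k_def)
  have U: "U \<subseteq> mspace Z" using X' Y' by (simp add: U_def)
  interpret Z: Metric_space "mspace Z" "mdist Z" by (rule Metric_space_mspace_mdist)
  have MW: "Metric_space (j ` U) (\<lambda>p q. mdist Z (k p) (k q))"
  proof
    fix p q s assume "p \<in> j ` U" "q \<in> j ` U"
    then obtain u v where uv: "p = j u" "q = j v" "u \<in> U" "v \<in> U" by blast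
    have "u \<in> mspace Z" "v \<in> mspace Z" using uv U by auto
    then have "mdist Z u v = 0 \<longleftrightarrow> u = v" by simp
    then show "mdist Z (k p) (k q) = 0 \<longleftrightarrow> p = q"
      using uv kj by metis
    assume "s \<in> j ` U"
    then show "mdist Z (k p) (k s) \<le> mdist Z (k p) (k q) + mdist Z (k q) (k s)"
      using uv U kj by (auto intro!: Z.triangle)
  qed (auto simp: Z.commute)
  define W where "W = metric (j ` U, \<lambda>p q. mdist Z (k p) (k q))"
  have mW [simp]: "mspace W = j ` U" "mdist W = (\<lambda>p q. mdist Z (k p) (k q))"
    using MW by (simp_all add: W_def Metric_space.mspace_metric Metric_space.mdist_metric)
  have transfer: "isometric_spaces (submetric W (j ` S)) T"
    if S: "S \<subseteq> U" and h: "bij_betw h S (mspace T)"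
      and hd: "\<And>x y. x \<in> S \<Longrightarrow> y \<in> S \<Longrightarrow> mdist T (h x) (h y) = mdist Z x y"
    for S and T :: "'t metric" and h
  proof -
    have sp: "mspace (submetric W (j ` S)) = j ` S" using S by auto
    have "bij_betw k (j ` S) S"
      using S kj by (intro bij_betw_byWitness[where f' = j]) (auto simp: subset_iff)
    then have "bij_betw (h \<circ> k) (j ` S) (mspace T)"
      using h by (rule bij_betw_trans)
    moreover have "mdist T ((h \<circ> k) p) ((h \<circ> k) q) = mdist (submetric W (j ` S)) p q"
      if "p \<in> j ` S" "q \<in> j ` S" for p q
      using that S kj hd by (auto simp: subset_iff)
    ultimately show ?thesis unfolding isometric_spaces_def sp by blast
  qed
  have XU: "X' \<subseteq> U" and YU: "Y' \<subseteq> U" by (auto simp: U_def)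
  have img: "k ` j ` S = S" if "S \<subseteq> U" for S
    using that kj by (force simp: subset_iff image_iff)
  have "hausdorff_distance W (j ` X') (j ` Y') = hausdorff_distance Z (k ` j ` X') (k ` j ` Y')"
    by (rule hausdorff_distance_image) (use U XU YU img in auto)
  then have "hausdorff_distance W (j ` X') (j ` Y') \<le> ereal r"
    using r img[OF XU] img[OF YU] by simp
  moreover have "isometric_spaces (submetric W (j ` X')) X" by (rule transfer[OF XU f fd])
  moreover have "isometric_spaces (submetric W (j ` Y')) Y" by (rule transfer[OF YU g gd])
  moreover have "j ` X' \<subseteq> mspace W" "j ` Y' \<subseteq> mspace W" using XU YU by auto
  ultimately show ?thesis
    unfolding gromov_hausdorff_distance_def using r(1) by (intro Inf_lower) blast
qed

end

theory Submission
  imports Defs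
begin

text \<open>
  Rounding coordinates shows that the Hausdorff distance is at most \<open>sqrt 2 / 2\<close>, and embedding both
  spaces in the plane itself shows that the Gromov--Hausdorff distance is at most the Hausdorff
  distance.  The content of the theorem is that the Gromov--Hausdorff distance is at least
  \<open>sqrt 2 / 2\<close>.

  If it were smaller, choosing for each point of the plane a nearby lattice point in the common
  ambient space would give a map \<open>f\<close> from the plane to the lattice that changes distances by at most
  some \<open>\<delta> < sqrt 2\<close> (\<open>gromov_hausdorff_distance_imp_coarse_isometry\<close>).  This is impossible
  (\<open>no_coarse_isometry_into_square_lattice\<close>), for the following reason.  Points that are close
  to each other have images at distance less than \<open>sqrt 2\<close>, so these images are equal or neighbours in the
  grid graph of the lattice.  Averaging \<open>f\<close> over small balls therefore yields a continuous map \<open>F\<close> at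
  bounded distance from \<open>f\<close> whose values lie on the edges of the grid; in particular \<open>F\<close> misses the
  centre \<open>p\<close> of the unit cell (\<open>cell_centre_notin_convex_hull\<close>).

  On the other hand a continuous map \<open>F\<close> that changes distances by a bounded amount must
  hit every point, as its degree on large circles is odd
  (\<open>continuous_coarse_isometry_hits\<close>).  The degree is not needed explicitly: if \<open>F - p\<close> has no zero on a disc,
  then it has a continuous logarithm there, and comparing the logarithm at antipodal boundary points
  yields some \<open>x\<close> for which \<open>F x - p\<close> and \<open>F (- x) - p\<close> point in the same direction.  Both have
  length close to the radius, so \<open>F x\<close> and \<open>F (- x)\<close> are at bounded distance, while \<open>x\<close> and
  \<open>- x\<close> are at distance twice the radius.
\<close>

section \<open>Continuous coarse isometries into the plane\<close>

text \<open>A form of the Borsuk--Ulam theorem.  The difference of the arguments at \<open>x\<close> and \<open>- x\<close>, read off from a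
  continuous logarithm on the ball, is an odd function on the connected sphere and hence vanishes
  somewhere.\<close>

lemma antipodal_positive_multiple:
  fixes F :: "'a::euclidean_space \<Rightarrow> complex"
  assumes dim: "2 \<le> DIM('a)" and r: "0 \<le> r"
    and cont: "continuous_on (cball 0 r) F" and nz: "\<And>x. x \<in> cball 0 r \<Longrightarrow> F x \<noteq> 0"
  obtains x s where "norm x = r" "0 < s" "F x = of_real s * F (- x)"
proof -
  obtain G where G: "continuous_on (cball 0 r) G" "\<And>x. x \<in> cball 0 r \<Longrightarrow> F x = exp (G x)"
    using continuous_logarithm_on_cball[OF cont nz] by blast
  define k where "k x = Im (G x) - Im (G (- x))" for x
  have "continuous_on (sphere 0 r) G"
    using G(1) by (rule continuous_on_subset) auto
  moreover have "continuous_on (sphere 0 r) (\<lambda>x. G (- x))"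
    by (rule continuous_on_compose2[where g = G and f = uminus, OF G(1)])
       (auto intro: continuous_on_minus continuous_on_id)
  ultimately have conn: "connected (k ` sphere 0 r)"
    unfolding k_def
    by (intro connected_continuous_image continuous_intros connected_sphere dim)
  obtain e :: 'a where e: "norm e = r"
    using vector_choose_size[OF r] by blast
  have "k e \<in> k ` sphere 0 r" "k (- e) \<in> k ` sphere 0 r"
    using e by auto
  moreover have "k (- e) = - k e"
    by (simp add: k_def)
  ultimately have "0 \<in> k ` sphere 0 r"
    using connectedD_interval[OF conn, of "k e" "- k e" 0]
      connectedD_interval[OF conn, of "- k e" "k e" 0] by (cases "k e \<le> 0") auto
  then obtain x where x: "norm x = r" "k x = 0"
    by auto
  define s where "s = exp (Re (G x) - Re (G (- x)))"
  have "G x = of_real (Re (G x) - Re (G (- x))) + G (- x)"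
    using x(2) by (simp add: k_def complex_eq_iff)
  then have "exp (G x) = of_real s * exp (G (- x))"
    unfolding s_def by (metis exp_add exp_of_real)
  then show ?thesis
    using x(1) G(2) by (intro that[of x s]) (auto simp: s_def)
qed

text \<open>If \<open>p\<close> were missed, the previous lemma would put the images of two antipodal boundary points on
  one ray from \<open>p\<close>, at nearly equal distances from \<open>p\<close>, although these images must be about
  \<open>2 * r\<close> apart.\<close>

lemma continuous_coarse_isometry_hits:
  fixes F :: "'a::euclidean_space \<Rightarrow> complex"
  assumes dim: "2 \<le> DIM('a)" and r: "0 \<le> r"
    and cont: "continuous_on (cball 0 r) F"
    and coarse: "\<And>x y. x \<in> cball 0 r \<Longrightarrow> y \<in> cball 0 r \<Longrightarrow> \<bar>dist (F x) (F y) - dist x y\<bar> \<le> C"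
    and large: "3 * C + 2 * dist (F 0) p < 2 * r"
  shows "p \<in> F ` cball 0 r"
proof (rule ccontr)
  assume "p \<notin> F ` cball 0 r"
  then have nz: "F x - p \<noteq> 0" if "x \<in> cball 0 r" for x
    using that by auto
  have cont': "continuous_on (cball 0 r) (\<lambda>x. F x - p)"
    by (intro continuous_intros cont)
  obtain x s where x: "norm x = r" and s: "0 < s" and eq: "F x - p = of_real s * (F (- x) - p)"
    using antipodal_positive_multiple[OF dim r cont' nz] by blast
  have near: "\<bar>dist (F y) p - r\<bar> \<le> C + dist (F 0) p" if "norm y = r" for y
    using coarse[of y 0] that dist_triangle[of "F y" p "F 0"] dist_triangle[of "F y" "F 0" p] r
    by (auto simp: dist_commute)
  have "F x - F (- x) = of_real (s - 1) * (F (- x) - p)"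
    using eq by (simp add: algebra_simps)
  then have "dist (F x) (F (- x)) = \<bar>s - 1\<bar> * dist (F (- x)) p"
    by (simp add: dist_norm norm_mult del: of_real_diff)
  also have "\<dots> = \<bar>(s - 1) * dist (F (- x)) p\<bar>"
    by (simp add: abs_mult)
  also have "\<dots> = \<bar>dist (F x) p - dist (F (- x)) p\<bar>"
    using eq s by (simp add: dist_norm norm_mult left_diff_distrib)
  also have "\<dots> \<le> 2 * C + 2 * dist (F 0) p"
    using near[of x] near[of "- x"] x by auto
  finally have "dist (F x) (F (- x)) \<le> 2 * C + 2 * dist (F 0) p" .
  moreover have "dist x (- x) = 2 * r"
    using x by (simp add: dist_norm scaleR_2[symmetric])
  then have "2 * r - C \<le> dist (F x) (F (- x))"
    using coarse[of x "- x"] x by auto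
  ultimately show False
    using large by linarith
qed

section \<open>Averaging a discontinuous map\<close>

text \<open>Interpolate the values of \<open>f\<close> on a finite \<open>\<eta>\<close>-net by a partition of unity made of tent functions.
  The bound by a convex hull, rather than by a distance from \<open>f x\<close>, is what later keeps \<open>F\<close> on
  the edges of the grid.\<close>

lemma continuous_local_average:
  fixes f :: "'a::metric_space \<Rightarrow> 'b::real_normed_vector"
  assumes S: "compact S" and \<eta>: "0 < \<eta>"
  obtains F where "continuous_on S F" "\<And>x. x \<in> S \<Longrightarrow> F x \<in> convex hull (f ` ball x \<eta>)"
proof -
  have "S \<subseteq> (\<Union>t\<in>S. ball t \<eta>)"
    using \<eta> by auto
  then obtain T where T: "T \<subseteq> S" "finite T" "S \<subseteq> (\<Union>t\<in>T. ball t \<eta>)"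
    using compactE_image[OF S, of S "\<lambda>t. ball t \<eta>"] by auto
  define w where "w t x = max 0 (\<eta> - dist t x)" for t x :: 'a
  define W where "W x = (\<Sum>t\<in>T. w t x)" for x
  have w0: "0 \<le> w t x" for t x
    by (simp add: w_def)
  have Wpos: "0 < W x" if "x \<in> S" for x
  proof -
    obtain t where "t \<in> T" "x \<in> ball t \<eta>"
      using T(3) \<open>x \<in> S\<close> by blast
    then show ?thesis
      unfolding W_def by (intro sum_pos2[of T t] T w0) (auto simp: w_def)
  qed
  define F where "F x = (\<Sum>t\<in>T. (w t x / W x) *\<^sub>R f t)" for x
  have contw: "continuous_on S (w t)" for t
    unfolding w_def by (intro continuous_intros)
  have "continuous_on S F"
    unfolding F_def
  proof (intro continuous_intros contw)
    show "continuous_on S W"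
      unfolding W_def by (intro continuous_intros contw)
    show "\<forall>x\<in>S. W x \<noteq> 0"
      using Wpos by (metis less_irrefl)
  qed
  moreover have "F x \<in> convex hull (f ` ball x \<eta>)" if x: "x \<in> S" for x
  proof -
    let ?T = "{t \<in> T. dist t x < \<eta>}"
    have zero: "w t x = 0" if "t \<in> T - ?T" for t
      using that by (auto simp: w_def)
    have "W x = (\<Sum>t\<in>?T. w t x)"
      unfolding W_def using T zero by (intro sum.mono_neutral_right) auto
    then have one: "(\<Sum>t\<in>?T. w t x / W x) = 1"
      using Wpos[OF x] by (simp add: sum_divide_distrib[symmetric])
    have "F x = (\<Sum>t\<in>?T. (w t x / W x) *\<^sub>R f t)"
      unfolding F_def using T zero by (intro sum.mono_neutral_right) auto
    also have "\<dots> \<in> convex hull (f ` ball x \<eta>)"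
      using T Wpos[OF x] w0 one
      by (intro convex_sum convex_convex_hull)
         (auto intro!: hull_inc simp: dist_commute intro: divide_nonneg_pos)
    finally show ?thesis .
  qed
  ultimately show ?thesis
    using that by blast
qed

section \<open>The square lattice\<close>

text \<open>Lattice points at distance less than \<open>sqrt 2\<close> share a coordinate.  If this holds for every pair in
  a set, then the whole set lies on one horizontal or one vertical grid line, and such a line avoids the
  centre of the cell.\<close>

lemma cell_centre_notin_convex_hull:
  fixes A :: "complex set"
  assumes int: "\<And>z. z \<in> A \<Longrightarrow> Re z \<in> \<int> \<and> Im z \<in> \<int>"
    and close: "\<And>y z. y \<in> A \<Longrightarrow> z \<in> A \<Longrightarrow> dist y z < sqrt 2"
  shows "Complex (1/2) (1/2) \<notin> convex hull A"
proof
  assume centre: "Complex (1/2) (1/2) \<in> convex hull A"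
  have ge1: "1 \<le> (a - b)\<^sup>2" if "a \<in> \<int>" "b \<in> \<int>" "a \<noteq> b" for a b :: real
    using Ints_nonzero_abs_ge1[of "a - b"] that by (simp add: abs_le_square_iff[of 1, simplified])
  have line: "Re y = Re z \<or> Im y = Im z" if "y \<in> A" "z \<in> A" for y z
  proof (rule ccontr)
    assume "\<not> ?thesis"
    then have "2 \<le> (Re y - Re z)\<^sup>2 + (Im y - Im z)\<^sup>2"
      using ge1[of "Re y" "Re z"] ge1[of "Im y" "Im z"] int that by force
    then have "sqrt 2 \<le> dist y z"
      by (simp add: dist_norm cmod_def)
    then show False
      using close that by force
  qed
  have half: "(1/2 :: real) \<notin> \<int>"
    using fraction_not_in_Ints[of 2 1, where 'a = real] by simp
  obtain a where a: "a \<in> A"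
    using centre by (metis convex_hull_empty empty_iff equals0I)
  have "A \<subseteq> {z. Re z = Re a} \<or> A \<subseteq> {z. Im z = Im a}"
  proof (rule ccontr)
    assume "\<not> ?thesis"
    then obtain b c where "b \<in> A" "Re b \<noteq> Re a" "c \<in> A" "Im c \<noteq> Im a"
      by blast
    then show False
      using line[of a b] line[of a c] line[of b c] a by auto
  qed
  moreover have "convex {z. Re z = Re a}" "convex {z. Im z = Im a}"
    using convex_hyperplane[of "1::complex" "Re a"] convex_hyperplane[of \<i> "Im a"]
    by (simp_all add: inner_complex_def)
  ultimately have "Complex (1/2) (1/2) \<in> {z. Re z = Re a} \<union> {z. Im z = Im a}"
    using centre hull_minimal[of A _ convex] by blast
  then have "Re a = 1/2 \<or> Im a = 1/2"
    by auto
  then show False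
    using half int[OF a] by metis
qed

text \<open>The bound is sharp: rounding the coordinates of points of the plane changes distances by at most
  \<open>sqrt 2\<close>.\<close>

lemma no_coarse_isometry_into_square_lattice:
  fixes f :: "'a::euclidean_space \<Rightarrow> complex"
  assumes dim: "2 \<le> DIM('a)"
    and int: "\<And>x. Re (f x) \<in> \<int> \<and> Im (f x) \<in> \<int>"
    and coarse: "\<And>x y. \<bar>dist (f x) (f y) - dist x y\<bar> \<le> \<delta>"
  shows "sqrt 2 \<le> \<delta>"
proof (rule ccontr)
  assume "\<not> sqrt 2 \<le> \<delta>"
  define p where "p = Complex (1/2) (1/2)"
  \<comment> \<open>Two points of a ball of radius \<open>\<eta>\<close> are less than \<open>2 * \<eta>\<close> apart, and \<open>2 * \<eta> + \<delta> = sqrt 2\<close>.\<close>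
  define \<eta> where "\<eta> = (sqrt 2 - \<delta>) / 2"
  have \<eta>: "0 < \<eta>"
    using \<open>\<not> sqrt 2 \<le> \<delta>\<close> by (simp add: \<eta>_def)
  have \<delta>: "0 \<le> \<delta>"
    using coarse[of 0 0] by simp
  \<comment> \<open>\<open>E\<close> bounds the distance from \<open>f\<close> to its average \<open>F\<close>, and \<open>C\<close> the resulting change of distances
    under \<open>F\<close>.\<close>
  define E where "E = \<delta> + \<eta>"
  define C where "C = 2 * E + \<delta>"
  define r where "r = 3 * C + 2 * E + 2 * dist (f 0) p"
  have r: "0 < r"
    using \<delta> \<eta> by (simp add: r_def C_def E_def add_nonneg_pos add_pos_nonneg)
  obtain F where cont: "continuous_on (cball 0 r) F"
    and hull: "\<And>x. x \<in> cball 0 r \<Longrightarrow> F x \<in> convex hull (f ` ball x \<eta>)"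
    using continuous_local_average[OF compact_cball \<eta>] by blast
  have "f ` ball x \<eta> \<subseteq> cball (f x) E" for x
  proof (intro image_subsetI)
    fix y assume "y \<in> ball x \<eta>"
    then show "f y \<in> cball (f x) E"
      using coarse[of x y] by (simp add: E_def)
  qed
  then have FE: "dist (f x) (F x) \<le> E" if "x \<in> cball 0 r" for x
    using hull[OF that] hull_minimal[of "f ` ball x \<eta>" "cball (f x) E" convex] by auto
  have "\<bar>dist (F x) (F y) - dist x y\<bar> \<le> C" if "x \<in> cball 0 r" "y \<in> cball 0 r" for x y
  proof -
    have "\<bar>dist (F x) (F y) - dist (f x) (f y)\<bar> \<le> dist (f x) (F x) + dist (f y) (F y)"
      by metric
    then show ?thesis
      using FE[OF that(1)] FE[OF that(2)] coarse[of x y] by (simp add: C_def)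
  qed
  moreover have "3 * C + 2 * dist (F 0) p < 2 * r"
  proof -
    have "dist (F 0) p \<le> E + dist (f 0) p"
      using FE[of 0] r dist_triangle[of "F 0" p "f 0"] by (simp add: dist_commute)
    then show ?thesis
      using r by (simp add: r_def)
  qed
  ultimately have "p \<in> F ` cball 0 r"
    using continuous_coarse_isometry_hits[OF dim less_imp_le[OF r] cont] by blast
  then obtain x where "p \<in> convex hull (f ` ball x \<eta>)"
    using hull by blast
  moreover have "dist (f y) (f z) < sqrt 2" if "y \<in> ball x \<eta>" "z \<in> ball x \<eta>" for y z
  proof -
    have "dist y z < 2 * \<eta>"
      using that dist_triangle2[of y z x] by (simp add: dist_commute)
    then show ?thesis
      using coarse[of y z] by (simp add: \<eta>_def)
  qed
  ultimately show False
    unfolding p_def using cell_centre_notin_convex_hull[of "f ` ball x \<eta>"] int by blast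
qed

section \<open>Comparing the two distances\<close>

lemma hausdorff_distance_approximation:
  assumes "hausdorff_distance Z A B < ereal r"
  obtains s where "0 < s" "s < r"
    "\<And>b. b \<in> B \<Longrightarrow> b \<in> mspace Z \<and> (\<exists>a\<in>A. a \<in> mspace Z \<and> mdist Z a b < s)"
proof -
  obtain s where "0 < s" "s < r" "B \<subseteq> metric_nbhd Z s A"
    using assms unfolding hausdorff_distance_def Inf_less_iff by auto
  then show ?thesis
    using that mem_metric_nbhd[of _ Z s A] by blast
qed

text \<open>Send a point of the copy of \<open>Y\<close> to a point of the copy of \<open>X\<close> that is less than \<open>r\<close> away in the ambient
  space; each of the two end points contributes at most \<open>r\<close> to the change of a distance.\<close>

lemma gromov_hausdorff_distance_imp_coarse_isometry:
  fixes X :: "'a metric" and Y :: "'b metric"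
  assumes "gromov_hausdorff_distance X Y < ereal r"
  obtains f where "f \<in> mspace Y \<rightarrow> mspace X"
    "\<And>x y. x \<in> mspace Y \<Longrightarrow> y \<in> mspace Y \<Longrightarrow> \<bar>mdist X (f x) (f y) - mdist Y x y\<bar> \<le> 2 * r"
proof -
  obtain Z :: "('a + 'b) metric" and X' Y' where X': "X' \<subseteq> mspace Z" and Y': "Y' \<subseteq> mspace Z"
    and isoX: "isometric_spaces (submetric Z X') X" and isoY: "isometric_spaces (submetric Z Y') Y"
    and "hausdorff_distance Z X' Y' < ereal r"
  proof -
    obtain q where "q < ereal r" and q: "q \<in> {ereal r | r. 0 \<le> r \<and>
       (\<exists>(Z :: ('a + 'b) metric) X' Y'.
          X' \<subseteq> mspace Z \<and> Y' \<subseteq> mspace Z \<and>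
          isometric_spaces (submetric Z X') X \<and> isometric_spaces (submetric Z Y') Y \<and>
          hausdorff_distance Z X' Y' \<le> ereal r)}"
      using assms unfolding gromov_hausdorff_distance_def Inf_less_iff by blast
    from q obtain Z :: "('a + 'b) metric" and X' Y' where "X' \<subseteq> mspace Z" "Y' \<subseteq> mspace Z"
      "isometric_spaces (submetric Z X') X" "isometric_spaces (submetric Z Y') Y"
      "hausdorff_distance Z X' Y' \<le> q"
      by blast
    then show ?thesis
      using that \<open>q < ereal r\<close> by (meson le_less_trans)
  qed
  then obtain s where s: "s < r" and near: "\<And>y. y \<in> Y' \<Longrightarrow> \<exists>x\<in>X'. mdist Z x y < s"
    by (meson hausdorff_distance_approximation)
  from isoX X' obtain g where g: "bij_betw g X' (mspace X)"
    and gd: "\<And>x y. x \<in> X' \<Longrightarrow> y \<in> X' \<Longrightarrow> mdist X (g x) (g y) = mdist Z x y"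
    unfolding isometric_spaces_def by (auto simp: Int_absorb2)
  from isoY Y' obtain h where h: "bij_betw h Y' (mspace Y)"
    and hd: "\<And>x y. x \<in> Y' \<Longrightarrow> y \<in> Y' \<Longrightarrow> mdist Y (h x) (h y) = mdist Z x y"
    unfolding isometric_spaces_def by (auto simp: Int_absorb2)
  define k where "k = inv_into Y' h"
  have k: "k y \<in> Y'" "h (k y) = y" if "y \<in> mspace Y" for y
    using h that unfolding k_def bij_betw_def by (auto intro: inv_into_into f_inv_into_f)
  obtain n where n: "\<And>y. y \<in> Y' \<Longrightarrow> n y \<in> X'" "\<And>y. y \<in> Y' \<Longrightarrow> mdist Z (n y) y < s"
    using near by metis
  interpret Z: Metric_space "mspace Z" "mdist Z"
    by (rule Metric_space_mspace_mdist)
  show ?thesis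
  proof (rule that[of "\<lambda>y. g (n (k y))"])
    show "(\<lambda>y. g (n (k y))) \<in> mspace Y \<rightarrow> mspace X"
      using g n k by (auto simp: bij_betw_def)
    fix x y assume xy: "x \<in> mspace Y" "y \<in> mspace Y"
    let ?x = "k x" and ?y = "k y"
    have mem: "?x \<in> Y'" "?y \<in> Y'" "n ?x \<in> X'" "n ?y \<in> X'"
      using k n xy by auto
    then have mem': "?x \<in> mspace Z" "?y \<in> mspace Z" "n ?x \<in> mspace Z" "n ?y \<in> mspace Z"
      using X' Y' by auto
    have "\<bar>mdist Z (n ?x) (n ?y) - mdist Z ?x ?y\<bar> \<le> mdist Z (n ?x) ?x + mdist Z (n ?y) ?y"
      using Z.triangle[of "n ?x" ?x "n ?y"] Z.triangle[of ?x ?y "n ?y"]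
        Z.triangle[of ?x "n ?x" ?y] Z.triangle[of "n ?x" "n ?y" ?y] mem' Z.commute
      by (smt (verit))
    also have "\<dots> \<le> 2 * r"
      using n(2)[OF mem(1)] n(2)[OF mem(2)] s by simp
    finally show "\<bar>mdist X (g (n (k x))) (g (n (k y))) - mdist Y x y\<bar> \<le> 2 * r"
      using gd[OF mem(3,4)] hd[OF mem(1,2)] k xy by simp
  qed
qed

lemma gromov_hausdorff_distance_le_hausdorff_distance:
  fixes Z :: "'a metric"
  assumes A: "A \<subseteq> mspace Z" and B: "B \<subseteq> mspace Z"
  shows "gromov_hausdorff_distance (submetric Z A) (submetric Z B) \<le> hausdorff_distance Z A B"
proof -
  have refl: "isometric_spaces X X" for X :: "'a metric"
    unfolding isometric_spaces_def by (intro exI[of _ "\<lambda>x. x"]) (auto simp: bij_betw_def)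
  have "0 \<le> hausdorff_distance Z A B"
    unfolding hausdorff_distance_def by (auto intro!: Inf_greatest)
  then show ?thesis
    using gromov_hausdorff_distance_le[OF A B refl refl]
    by (cases "hausdorff_distance Z A B") auto
qed

lemma hausdorff_distance_integer_lattice_le:
  "hausdorff_distance euclidean_metric (integer_lattice :: (real ^ 2) set) UNIV \<le> ereal (sqrt 2 / 2)"
proof (rule ereal_le_epsilon2)
  fix e :: real assume e: "0 < e"
  have pos: "0 < sqrt 2 / 2 + e"
    using e by (simp add: add_pos_pos)
  have "\<exists>a\<in>integer_lattice. dist a x < sqrt 2 / 2 + e" for x :: "real ^ 2"
  proof
    let ?a = "(\<chi> i. of_int (round (x $ i))) :: real ^ 2"
    show "?a \<in> integer_lattice"
      by (simp add: integer_lattice_def)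
    have sq: "(of_int (round (x $ i)) - x $ i)\<^sup>2 \<le> (1/2)\<^sup>2" for i
      using of_int_round_abs_le[of "x $ i"] by (metis abs_le_square_iff abs_of_nonneg half_gt_zero less_eq_real_def zero_less_one)
    have "dist ?a x = sqrt (\<Sum>i\<in>UNIV. (of_int (round (x $ i)) - x $ i)\<^sup>2)"
      by (simp add: dist_norm norm_vec_def L2_set_def)
    also have "\<dots> \<le> sqrt (2 / 2\<^sup>2)"
      using sq[of 1] sq[of 2] by (intro real_sqrt_le_mono) (simp add: sum_2 power2_eq_square)
    also have "\<dots> = sqrt 2 / 2"
      by (simp add: real_sqrt_divide real_div_sqrt)
    finally show "dist ?a x < sqrt 2 / 2 + e"
      using e by simp
  qed
  then have near: "UNIV \<subseteq> metric_nbhd euclidean_metric (sqrt 2 / 2 + e) (integer_lattice :: (real ^ 2) set)"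
    by (auto simp: mem_metric_nbhd)
  have "x \<in> metric_nbhd euclidean_metric (sqrt 2 / 2 + e) UNIV" for x :: "real ^ 2"
    unfolding mem_metric_nbhd using pos by (intro bexI[of _ x]) auto
  then have "integer_lattice \<subseteq> metric_nbhd euclidean_metric (sqrt 2 / 2 + e) (UNIV :: (real ^ 2) set)"
    by blast
  with near show "hausdorff_distance euclidean_metric (integer_lattice :: (real ^ 2) set) UNIV
    \<le> ereal (sqrt 2 / 2) + ereal e"
    using pos unfolding hausdorff_distance_def by (intro Inf_lower) auto
qed

lemma gromov_hausdorff_distance_integer_lattice_ge:
  "ereal (sqrt 2 / 2) \<le> gromov_hausdorff_distance
     (submetric euclidean_metric (integer_lattice :: (real ^ 2) set)) (euclidean_metric :: (real ^ 2) metric)"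
    (is "_ \<le> ?d")
proof (rule ccontr)
  assume "\<not> ?thesis"
  then obtain r where r: "?d < ereal r" "r < sqrt 2 / 2"
    by (metis ereal_dense2 ereal_less_eq(3) not_le)
  obtain f :: "real ^ 2 \<Rightarrow> real ^ 2" where f: "\<And>x. f x \<in> integer_lattice"
    and fd: "\<And>x y. \<bar>dist (f x) (f y) - dist x y\<bar> \<le> 2 * r"
    using gromov_hausdorff_distance_imp_coarse_isometry[OF r(1)] by (auto simp: Pi_iff)
  define c :: "real ^ 2 \<Rightarrow> complex" where "c v = Complex (v $ 1) (v $ 2)" for v
  have "dist (c u) (c v) = dist u v" for u v
    by (simp add: c_def dist_norm cmod_def norm_vec_def L2_set_def sum_2)
  then have "sqrt 2 \<le> 2 * r"
    using f fd by (intro no_coarse_isometry_into_square_lattice[of "\<lambda>x. c (f x)"])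
      (auto simp: c_def integer_lattice_def)
  then show False
    using r(2) by simp
qed

theorem mainTheorem1:
  shows "gromov_hausdorff_distance
           (submetric euclidean_metric (integer_lattice :: (real ^ 2) set))
           (euclidean_metric :: (real ^ 2) metric)
       = hausdorff_distance euclidean_metric (integer_lattice :: (real ^ 2) set) UNIV"
proof (rule antisym)
  show "gromov_hausdorff_distance
           (submetric euclidean_metric (integer_lattice :: (real ^ 2) set))
           (euclidean_metric :: (real ^ 2) metric)
       \<le> hausdorff_distance euclidean_metric (integer_lattice :: (real ^ 2) set) UNIV"
    using gromov_hausdorff_distance_le_hausdorff_distance[of integer_lattice
        "euclidean_metric :: (real ^ 2) metric" UNIV] by simp
  show "hausdorff_distance euclidean_metric (integer_lattice :: (real ^ 2) set) UNIV
     \<le> gromov_hausdorff_distance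
           (submetric euclidean_metric (integer_lattice :: (real ^ 2) set))
           (euclidean_metric :: (real ^ 2) metric)"
    using hausdorff_distance_integer_lattice_le gromov_hausdorff_distance_integer_lattice_ge
    by (rule order_trans)
qed

end
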